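(* Let $n\ge 1$ and let $k=k(n)$ be the integer defined in the context. Let $B\subset\mathbb{R}^n$ be a closed Euclidean ball, let $S$ be a regular $n$-dimensional simplex inscribed into $B$, let $\lambda_1,\dots,\lambda_{n+1}$ be the basic Lagrange polynomials of $S$, and let $P:C(B)\to\Pi_1(\mathbb{R}^n)$ be the interpolation projector whose nodes are the vertices of $S$. Consider an arbitrary $(k-1)$-dimensional face $G$ of $S$, and let $H$ be the $(n-k)$-dimensional face of $S$ which contains the vertices of $S$ not belonging to $G$. Denote by $g$ and $h$ the centers of gravity of $G$ and $H$ respectively. Let $y$ be the point where the straight line $(gh)$ intersects the boundary sphere of $B$ in the direction from $g$ to $h$ (i.e. the point of the form $g+t(h-g)$, $t>0$, on the boundary sphere). Then $$\sum_{j=1}^{n+1}|\lambda_j(y)|=\|P\|_B .$$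
   Context: Simplex inscribed into a ball: all its vertices lie on the boundary sphere of the ball. Let $S$ be a nondegenerate simplex in $\mathbb{R}^n$ with vertices $x^{(1)},\dots,x^{(n+1)}$. The basic Lagrange polynomials of $S$ are the polynomials $\lambda_1,\dots,\lambda_{n+1}$ of degree $\le 1$ in $n$ variables with $\lambda_j(x^{(i)})=\delta_j^i$; equivalently, $\lambda_j(x)$ are the barycentric coordinates of $x$ with respect to $S$. $C(B)$ is the space of continuous functions $f:B\to\mathbb{R}$ with norm $\|f\|_{C(B)}=\max_{x\in B}|f(x)|$. $\Pi_1(\mathbb{R}^n)$ is the set of polynomials in $n$ variables of degree $\le 1$. The interpolation projector $P:C(B)\to\Pi_1(\mathbb{R}^n)$ with nodes $x^{(j)}\in B$ is defined by $Pf(x^{(j)})=f(x^{(j)})$, $j=1,\dots,n+1$. $\|P\|_B$ denotes the norm of $P$ as an operator from $C(B)$ to $C(B)$. The center of gravity of a face is the arithmetic mean of its vertices. Definition of $k(n)$: put $$\psi(t):=\frac{2\sqrt n}{n+1}\bigl(t(n+1-t)\bigr)^{1/2}+\left|1-\frac{2t}{n+1}\right|,\quad 0\le t\le n+1,\qquad a:=\left\lfloor \frac{n+1}{2}-\frac{\sqrt{n+1}}{2}\right\rfloor ,$$ and let $k(n):=a+1$ if $\psi(a+1)\ge\psi(a)$, and $k(n):=a$ if $\psi(a+1)<\psi(a)$. *)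

theory Defs
  imports "HOL-Analysis.Analysis"
begin

definition psi :: "nat \<Rightarrow> real \<Rightarrow> real" where
  "psi n t = 2 * sqrt (real n) / (real n + 1) * sqrt (t * (real n + 1 - t))
             + \<bar>1 - 2 * t / (real n + 1)\<bar>"

definition a_num :: "nat \<Rightarrow> int" where
  "a_num n = \<lfloor>(real n + 1) / 2 - sqrt (real n + 1) / 2\<rfloor>"

definition k_num :: "nat \<Rightarrow> int" where
  "k_num n = (if psi n (of_int (a_num n + 1)) \<ge> psi n (of_int (a_num n))
              then a_num n + 1 else a_num n)"

definition vertices :: "'a::euclidean_space set \<Rightarrow> 'a set" where
  "vertices S = {v. v extreme_point_of S}"

text \<open>Regularity: all edges have the same length. Nondegeneracy is part of the
  library predicate \<open>d simplex S\<close>.\<close>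

definition regular_simplex :: "int \<Rightarrow> 'a::euclidean_space set \<Rightarrow> bool" where
  "regular_simplex d S \<longleftrightarrow> d simplex S \<and>
     (\<exists>l. \<forall>u\<in>vertices S. \<forall>v\<in>vertices S. u \<noteq> v \<longrightarrow> dist u v = l)"

definition center_of_gravity :: "'a::euclidean_space set \<Rightarrow> 'a" where
  "center_of_gravity F = (\<Sum>v\<in>vertices F. v) /\<^sub>R real (card (vertices F))"

text \<open>Polynomials in \<open>CARD('n)\<close> variables of degree at most one, as functions.\<close>

definition Pi1 :: "(real ^ 'n \<Rightarrow> real) set" where
  "Pi1 = {p. \<exists>b a. p = (\<lambda>x. b + (\<Sum>i\<in>UNIV. a $ i * x $ i))}"

definition lagrange_basis :: "nat \<Rightarrow> (nat \<Rightarrow> real ^ 'n) \<Rightarrow> (nat \<Rightarrow> real ^ 'n \<Rightarrow> real) \<Rightarrow> bool" where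
  "lagrange_basis m x lam \<longleftrightarrow>
     (\<forall>j\<in>{1..m}. lam j \<in> Pi1 \<and> (\<forall>i\<in>{1..m}. lam j (x i) = (if i = j then 1 else 0)))"

text \<open>The space \<open>C(B)\<close> is rendered by total functions that are continuous on \<open>B\<close>; only
  their values on \<open>B\<close> matter below. For compact nonempty \<open>B\<close> the supremum in
  \<open>C_norm\<close> is a maximum.\<close>

definition C_norm :: "'a::topological_space set \<Rightarrow> ('a \<Rightarrow> real) \<Rightarrow> real" where
  "C_norm B f = (SUP x\<in>B. \<bar>f x\<bar>)"

definition C_opnorm :: "'a::topological_space set \<Rightarrow> (('a \<Rightarrow> real) \<Rightarrow> ('a \<Rightarrow> real)) \<Rightarrow> real" where
  "C_opnorm B P = (SUP f\<in>{f. continuous_on B f \<and> C_norm B f \<le> 1}. C_norm B (P f))"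

definition interpolation_projector ::
  "(real ^ 'n) set \<Rightarrow> (real ^ 'n) set \<Rightarrow> ((real ^ 'n \<Rightarrow> real) \<Rightarrow> (real ^ 'n \<Rightarrow> real)) \<Rightarrow> bool" where
  "interpolation_projector B X P \<longleftrightarrow> X \<subseteq> B \<and>
     (\<forall>f. continuous_on B f \<longrightarrow> P f \<in> Pi1 \<and> (\<forall>v\<in>X. P f v = f v))"

end

theory Submission
  imports Defs
begin

text \<open>
  Write \<open>N = n + 1\<close>. A point \<open>z\<close> is the affine combination of the vertices with weights
  \<open>\<lambda>\<^sub>j z\<close>, and because all vertices are at distance \<open>r\<close> from the centre and at
  equal mutual distance \<open>l\<close>, its squared distance from the centre is
  \<open>r\<^sup>2 - l\<^sup>2 / 2 * (1 - \<Sum>\<^sub>j (\<lambda>\<^sub>j z)\<^sup>2)\<close> (\<open>dist_sphere_affine_combination\<close>). In barycentric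
  coordinates the ball is therefore the set \<open>\<Sum> \<lambda>\<^sub>j = 1\<close>, \<open>\<Sum> \<lambda>\<^sub>j\<^sup>2 \<le> 1\<close>, and its boundary is
  \<open>\<Sum> \<lambda>\<^sub>j\<^sup>2 = 1\<close>. The geometry has disappeared: since \<open>P f = \<Sum>\<^sub>j f (x\<^sub>j) \<lambda>\<^sub>j\<close>, the norm of \<open>P\<close> is the
  maximum of \<open>\<Sum> \<bar>\<lambda>\<^sub>j\<bar>\<close> under these two constraints, and any maximiser in the ball computes it
  (\<open>C_opnorm_interpolation_projector\<close>). It remains to see that \<open>y\<close> is a maximiser.

  Upper bound. If \<open>m\<close> of the coordinates are negative, the Cauchy-Schwarz inequality for the
  centred coordinates and the centred sign vector gives \<open>\<Sum> \<bar>\<lambda>\<^sub>j\<bar> \<le> \<phi>(m)\<close>, where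
  \<open>\<phi>(t) = 2 \<surd>n / N * \<surd>(t (N - t)) + 1 - 2 t / N\<close> (\<open>sum_abs_le_phi\<close>). This \<open>\<phi>\<close> is \<open>\<psi>\<close> without the
  absolute value, so it agrees with \<open>\<psi>\<close> on the left half of \<open>[0, N]\<close>. It increases up to
  \<open>(N - \<surd>N) / 2\<close> and decreases afterwards, so among integers its maximum is at one of the two
  neighbours \<open>a\<close>, \<open>a + 1\<close> of that point; \<open>k\<close> is the better of the two (\<open>phi_le_psi_k_num\<close>).

  Attainment. At \<open>y\<close> the coordinates are \<open>(1 - t) / k\<close> on the vertices of \<open>G\<close> and
  \<open>t / (N - k)\<close> on those of \<open>H\<close>. The equation \<open>\<Sum> \<lambda>\<^sub>j\<^sup>2 = 1\<close> is then quadratic in \<open>t\<close>, its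
  only positive root is the larger one, and for it \<open>2 t - 1 = \<psi>(k)\<close>
  (\<open>psi_k_num_attained\<close>). As \<open>\<Sum> \<bar>\<lambda>\<^sub>j y\<bar> = \<bar>1 - t\<bar> + \<bar>t\<bar> \<ge> 2 t - 1\<close>, the upper bound is reached.
\<close>

section \<open>The extremal function and its maximum over the integers\<close>

text \<open>
  Keeping the sign of \<open>1 - 2 t / (n + 1)\<close> makes this function concave on \<open>[0, n + 1]\<close>, unlike
  \<open>psi\<close>, and it is the form in which the bound for \<open>\<Sum> \<bar>\<lambda>\<^sub>j\<bar>\<close> arises when \<open>t\<close> of the
  coordinates are negative.
\<close>

definition phi :: "nat \<Rightarrow> real \<Rightarrow> real" where
  "phi n t = 2 * sqrt (real n) / (real n + 1) * sqrt (t * (real n + 1 - t))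
             + (1 - 2 * t / (real n + 1))"

lemma phi_le_psi: "phi n t \<le> psi n t"
  by (simp add: phi_def psi_def)

lemma phi_eq_psi:
  assumes "t \<le> (real n + 1) / 2"
  shows "phi n t = psi n t"
proof -
  have "2 * t / (real n + 1) \<le> 1"
    using assms by (simp add: divide_simps)
  then show ?thesis by (simp add: phi_def psi_def)
qed

text \<open>
  The derivative of \<open>phi\<close> has the sign of \<open>\<surd>n (N - 2 t) - 2 \<surd>(t (N - t))\<close>. By
  \<open>4 t (N - t) = N\<^sup>2 - (N - 2 t)\<^sup>2\<close>, comparing the squares of the two terms amounts to comparing
  \<open>(N - 2 t)\<^sup>2\<close> with \<open>N\<close>, which locates the sign change at \<open>(N - \<surd>N) / 2\<close>.
\<close>

lemma phi_slope_bounds: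
  fixes t :: real
  assumes "0 \<le> t" "t \<le> real n + 1"
  shows "t \<le> (real n + 1) / 2 - sqrt (real n + 1) / 2 \<Longrightarrow>
           2 * sqrt (t * (real n + 1 - t)) \<le> sqrt (real n) * (real n + 1 - 2 * t)"
    and "(real n + 1) / 2 - sqrt (real n + 1) / 2 \<le> t \<Longrightarrow>
           sqrt (real n) * (real n + 1 - 2 * t) \<le> 2 * sqrt (t * (real n + 1 - t))"
proof -
  define N where "N = real n + 1"
  have N: "N > 0" "real n = N - 1" "0 \<le> t" "t \<le> N" using assms by (auto simp: N_def)
  have W: "(2 * sqrt (t * (N - t)))\<^sup>2 = N\<^sup>2 - (N - 2 * t)\<^sup>2"
    using N by (simp add: power_mult_distrib) (simp add: power2_eq_square algebra_simps)
  have R: "(sqrt (real n) * (N - 2 * t))\<^sup>2 = N * (N - 2 * t)\<^sup>2 - (N - 2 * t)\<^sup>2"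
    by (simp add: power_mult_distrib N(2)[symmetric]) (simp add: N(2) algebra_simps)
  have root: "N * (sqrt N)\<^sup>2 = N\<^sup>2" using N by (simp add: power2_eq_square)
  {
    assume "t \<le> (real n + 1) / 2 - sqrt (real n + 1) / 2"
    then have le: "sqrt N \<le> N - 2 * t" by (simp add: N_def field_simps)
    then have pos: "0 \<le> N - 2 * t" using N(1) real_sqrt_ge_zero[of N] by linarith
    have "N * (sqrt N)\<^sup>2 \<le> N * (N - 2 * t)\<^sup>2"
      using le N by (intro mult_left_mono power_mono) auto
    then have "(2 * sqrt (t * (N - t)))\<^sup>2 \<le> (sqrt (real n) * (N - 2 * t))\<^sup>2"
      unfolding W R root by simp
    then show "2 * sqrt (t * (real n + 1 - t)) \<le> sqrt (real n) * (real n + 1 - 2 * t)"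
      unfolding N_def[symmetric] by (rule power2_le_imp_le) (use pos in simp)
  }
  {
    assume "(real n + 1) / 2 - sqrt (real n + 1) / 2 \<le> t"
    then have le: "N - 2 * t \<le> sqrt N" by (simp add: N_def field_simps)
    show "sqrt (real n) * (real n + 1 - 2 * t) \<le> 2 * sqrt (t * (real n + 1 - t))"
    proof (cases "0 \<le> N - 2 * t")
      case True
      have "N * (N - 2 * t)\<^sup>2 \<le> N * (sqrt N)\<^sup>2"
        using le N True by (intro mult_left_mono power_mono) auto
      then have "(sqrt (real n) * (N - 2 * t))\<^sup>2 \<le> (2 * sqrt (t * (N - t)))\<^sup>2"
        unfolding W R root by simp
      then show ?thesis
        unfolding N_def[symmetric] by (rule power2_le_imp_le) (use N in simp)
    next
      case False
      then have "sqrt (real n) * (N - 2 * t) \<le> 0" by (simp add: mult_nonneg_nonpos)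
      also have "0 \<le> 2 * sqrt (t * (N - t))" using N by simp
      finally show ?thesis unfolding N_def .
    qed
  }
qed

text \<open>
  Rationalising the difference of the two square roots replaces the mean value theorem: up
  to a nonnegative factor the increment of \<open>phi\<close> is \<open>t - s\<close> times the sum of the two slope terms
  of \<open>phi_slope_bounds\<close>, so their sign decides its direction.
\<close>

lemma phi_diff:
  fixes s t :: real
  assumes "0 \<le> s" "s \<le> real n + 1" "0 \<le> t" "t \<le> real n + 1"
  defines "W \<equiv> \<lambda>u. sqrt (u * (real n + 1 - u))"
  shows "(real n + 1) * (W s + W t) * (phi n t - phi n s) =
         (t - s) * (sqrt (real n) * (real n + 1 - 2 * s) - 2 * W s
                  + (sqrt (real n) * (real n + 1 - 2 * t) - 2 * W t))"
proof -
  have W2: "W s * W s = s * (real n + 1 - s)" "W t * W t = t * (real n + 1 - t)"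
    using assms by (simp_all add: W_def)
  have "(real n + 1) * (phi n t - phi n s) = 2 * sqrt (real n) * (W t - W s) - 2 * (t - s)"
  proof -
    have "(real n + 1) * phi n u = 2 * sqrt (real n) * W u + (real n + 1 - 2 * u)" for u
      by (simp add: phi_def W_def distrib_left right_diff_distrib)
    then show ?thesis by (simp add: right_diff_distrib)
  qed
  then have "(real n + 1) * (W s + W t) * (phi n t - phi n s) =
      (W s + W t) * (2 * sqrt (real n) * (W t - W s) - 2 * (t - s))"
    by (metis mult.assoc mult.commute)
  also have "\<dots> = 2 * sqrt (real n) * (W t * W t - W s * W s) - 2 * (t - s) * (W s + W t)"
    by (simp add: algebra_simps)
  also have "\<dots> = (t - s) * (sqrt (real n) * (real n + 1 - 2 * s) - 2 * W s
                  + (sqrt (real n) * (real n + 1 - 2 * t) - 2 * W t))"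
    unfolding W2 by (simp add: algebra_simps)
  finally show ?thesis .
qed

lemma sum_sqrt_pos:
  fixes s t N :: real
  assumes "0 \<le> s" "s < t" "t \<le> N" "\<not> (s = 0 \<and> t = N)"
  shows "0 < sqrt (s * (N - s)) + sqrt (t * (N - t))"
proof (cases "s = 0")
  case True
  then have "0 < sqrt (t * (N - t))" using assms by simp
  then show ?thesis using True by simp
next
  case False
  then have "0 < sqrt (s * (N - s))" "0 \<le> sqrt (t * (N - t))" using assms by simp_all
  then show ?thesis by linarith
qed

lemma phi_increasing:
  assumes "0 \<le> s" "s \<le> t" "t \<le> (real n + 1) / 2 - sqrt (real n + 1) / 2"
  shows "phi n s \<le> phi n t"
proof (cases "s = t")
  case False
  have tN: "t < real n + 1"
  proof -
    have "0 < sqrt (real n + 1)" "0 \<le> real n" by simp_all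
    then show ?thesis using assms(3) by argo
  qed
  have "0 \<le> (real n + 1) * (sqrt (s * (real n + 1 - s)) + sqrt (t * (real n + 1 - t)))
           * (phi n t - phi n s)"
    using phi_slope_bounds(1)[of s n] phi_slope_bounds(1)[of t n] assms tN
    by (subst phi_diff) (auto intro!: mult_nonneg_nonneg)
  moreover have "0 < sqrt (s * (real n + 1 - s)) + sqrt (t * (real n + 1 - t))"
    using assms False tN by (intro sum_sqrt_pos) auto
  ultimately show ?thesis by (simp add: zero_le_mult_iff mult_le_0_iff)
qed simp

lemma phi_decreasing:
  assumes "(real n + 1) / 2 - sqrt (real n + 1) / 2 \<le> s" "0 < s" "s \<le> t" "t \<le> real n + 1"
  shows "phi n t \<le> phi n s"
proof (cases "s = t")
  case False
  have "(real n + 1) * (sqrt (s * (real n + 1 - s)) + sqrt (t * (real n + 1 - t)))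
           * (phi n t - phi n s) \<le> 0"
    using phi_slope_bounds(2)[of s n] phi_slope_bounds(2)[of t n] assms
    by (subst phi_diff) (auto intro!: mult_nonneg_nonpos)
  moreover have "0 < sqrt (s * (real n + 1 - s)) + sqrt (t * (real n + 1 - t))"
    using assms False by (intro sum_sqrt_pos) auto
  ultimately show ?thesis by (simp add: mult_le_0_iff)
qed simp

lemma a_num_nonneg: "0 \<le> a_num n"
proof -
  have "sqrt (real n + 1) \<le> real n + 1" by (rule real_le_lsqrt) (auto simp: power2_eq_square)
  then show ?thesis by (simp add: a_num_def)
qed

lemma psi_k_num: "psi n (k_num n) = max (psi n (a_num n)) (psi n (a_num n + 1))"
  by (simp add: k_num_def)

text \<open>
  No integer lies strictly between \<open>a\<close> and \<open>a + 1\<close>, which enclose the turning point of \<open>phi\<close>;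
  so every integer is on one of its two monotone branches, beyond \<open>a\<close> or \<open>a + 1\<close>.
\<close>

lemma phi_le_psi_k_num:
  assumes "m \<le> n + 1"
  shows "phi n (real m) \<le> psi n (k_num n)"
proof (cases "int m \<le> a_num n")
  case True
  have "real_of_int (a_num n) \<le> (real n + 1) / 2 - sqrt (real n + 1) / 2"
    unfolding a_num_def by (rule of_int_floor_le)
  moreover have "real m \<le> real_of_int (a_num n)" using True by linarith
  ultimately have "phi n (real m) \<le> phi n (a_num n)" by (intro phi_increasing) auto
  also have "\<dots> \<le> psi n (a_num n)" by (rule phi_le_psi)
  finally show ?thesis by (simp add: psi_k_num)
next
  case False
  have "(real n + 1) / 2 - sqrt (real n + 1) / 2 \<le> a_num n + 1"
    unfolding a_num_def by linarith
  moreover have "a_num n + 1 \<le> real m" using False by linarith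
  moreover have "real m \<le> real n + 1" using assms by linarith
  ultimately have "phi n (real m) \<le> phi n (a_num n + 1)"
    using a_num_nonneg[of n] by (intro phi_decreasing) auto
  also have "\<dots> \<le> psi n (a_num n + 1)" by (rule phi_le_psi)
  finally show ?thesis by (simp add: psi_k_num)
qed

text \<open>
  Only \<open>a = 0\<close> needs an argument; there the definition compares \<open>\<psi>(0) = 1\<close> with
  \<open>\<psi>(1) = (3 n - 1) / (n + 1)\<close>.
\<close>

lemma k_num_ge_1:
  assumes "1 \<le> n"
  shows "1 \<le> k_num n"
proof (cases "a_num n = 0")
  case True
  have "\<bar>1 - 2 / (real n + 1)\<bar> = 1 - 2 / (real n + 1)"
    using assms by (simp add: field_simps)
  then have "psi n 1 = 2 * real n / (real n + 1) + (1 - 2 / (real n + 1))"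
    using assms by (simp add: psi_def)
  also have "\<dots> \<ge> 1"
    using assms divide_right_mono[of 2 "2 * real n" "real n + 1"] by simp
  finally have "psi n 0 \<le> psi n 1" by (simp add: psi_def)
  then show ?thesis by (simp add: k_num_def True)
next
  case False
  then show ?thesis using a_num_nonneg[of n] by (simp add: k_num_def)
qed

text \<open>
  The turning point is \<open>\<surd>N / 2\<close> below the midpoint \<open>N / 2\<close>. For \<open>N \<ge> 4\<close> this is at least \<open>1\<close>, so
  even \<open>a + 1\<close> does not pass the midpoint; for \<open>N = 2, 3\<close> one has \<open>a + 1 = 1\<close>.
\<close>

lemma k_num_le_half:
  assumes "1 \<le> n"
  shows "2 * k_num n \<le> int n + 1"
proof -
  have "2 * (a_num n + 1) \<le> int n + 1"
  proof (cases "n < 3")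
    case True
    have "1 < sqrt (real n + 1)" using assms by simp
    moreover have "real n \<le> 2" using True by simp
    ultimately have "(real n + 1) / 2 - sqrt (real n + 1) / 2 < 1" by argo
    then have "a_num n < 1" by (simp add: a_num_def floor_less_iff)
    then show ?thesis using assms by presburger
  next
    case False
    then have "2 \<le> sqrt (real n + 1)" by (intro real_le_rsqrt) auto
    moreover have "real_of_int (a_num n) \<le> (real n + 1) / 2 - sqrt (real n + 1) / 2"
      unfolding a_num_def by (rule of_int_floor_le)
    ultimately have "real_of_int (2 * (a_num n + 1)) \<le> real_of_int (int n + 1)"
      by (simp add: field_simps)
    then show ?thesis by (simp only: of_int_le_iff)
  qed
  then show ?thesis by (simp add: k_num_def)
qed

section \<open>Maximising the sum of absolute values\<close>

text \<open>
  With \<open>e\<close> the sign vector and \<open>b = 1 - 2 m / N\<close> its mean, \<open>\<Sum> \<bar>\<lambda>\<^sub>j\<bar> = \<Sum> (e\<^sub>j - b) (\<lambda>\<^sub>j - 1 / N) + b\<close>,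
  and the two centred vectors have squared norms \<open>N (1 - b\<^sup>2)\<close> and at most \<open>n / N\<close>. Centring
  is what makes Cauchy-Schwarz sharp here: it becomes an equality when
  the coordinates take one value on the negative indices and one on the others, which is the
  shape of the coordinates of \<open>y\<close> in the theorem.
\<close>

lemma sum_abs_le_phi:
  fixes lam :: "'i \<Rightarrow> real"
  assumes fin: "finite J" and card: "card J = n + 1"
    and one: "sum lam J = 1" and sq: "(\<Sum>j\<in>J. (lam j)\<^sup>2) \<le> 1"
  shows "(\<Sum>j\<in>J. \<bar>lam j\<bar>) \<le> phi n (card {j\<in>J. lam j < 0})"
proof -
  define N where "N = real n + 1"
  define m where "m = real (card {j\<in>J. lam j < 0})"
  define e where "e j = (if lam j < 0 then -1 else 1 :: real)" for j
  define b where "b = 1 - 2 * m / N"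
  have N: "N > 0" "real (card J) = N" by (auto simp: N_def card)
  have "m \<le> N" unfolding m_def N(2)[symmetric] using fin by (auto intro!: card_mono)
  have "e j = 1 - 2 * (if lam j < 0 then 1 else 0)" for j by (simp add: e_def)
  then have "sum e J = (\<Sum>j\<in>J. 1 - 2 * (if lam j < 0 then 1 else 0 :: real))" by simp
  also have "\<dots> = N - 2 * (\<Sum>j\<in>J. if lam j < 0 then 1 else 0)"
    by (simp add: sum_subtractf N flip: sum_distrib_left)
  also have "(\<Sum>j\<in>J. if lam j < 0 then 1 else 0 :: real) = m"
    by (simp add: m_def sum.If_cases fin Collect_conj_eq)
  finally have "sum e J = N - 2 * m" .
  then have se: "sum e J = N * b" using N by (simp add: b_def right_diff_distrib)
  have "(e j)\<^sup>2 = 1" for j by (simp add: e_def)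
  then have se2: "(\<Sum>j\<in>J. (e j - b)\<^sup>2) = N * (1 - b\<^sup>2)"
    by (simp add: power2_diff sum.distrib sum_subtractf N se flip: sum_distrib_left sum_distrib_right)
       (simp add: power2_eq_square algebra_simps)
  have sl2: "(\<Sum>j\<in>J. (lam j - 1 / N)\<^sup>2) \<le> real n / N"
  proof -
    have "(\<Sum>j\<in>J. (lam j - 1 / N)\<^sup>2) = (\<Sum>j\<in>J. (lam j)\<^sup>2) + N * (1 / N)\<^sup>2 - 2 * sum lam J / N"
      by (simp add: power2_diff sum.distrib sum_subtractf N flip: sum_distrib_left sum_divide_distrib)
    also have "\<dots> = (\<Sum>j\<in>J. (lam j)\<^sup>2) - 1 / N"
      using N by (simp add: one power2_eq_square field_simps)
    also have "\<dots> \<le> 1 - 1 / N" using sq by simp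
    also have "\<dots> = real n / N" using N by (simp add: N_def field_simps)
    finally show ?thesis .
  qed
  have "(\<Sum>j\<in>J. \<bar>lam j\<bar>) = (\<Sum>j\<in>J. e j * lam j)"
    by (rule sum.cong) (auto simp: e_def)
  also have "\<dots> = (\<Sum>j\<in>J. (e j - b) * (lam j - 1 / N)) + b"
  proof -
    have "(\<Sum>j\<in>J. (e j - b) * (lam j - 1 / N)) =
          (\<Sum>j\<in>J. e j * lam j) - sum e J / N - b * sum lam J + N * (b / N)"
      by (simp add: algebra_simps sum.distrib sum_subtractf N flip: sum_distrib_left sum_divide_distrib)
    then show ?thesis using N by (simp add: se one)
  qed
  also have "(\<Sum>j\<in>J. (e j - b) * (lam j - 1 / N)) \<le>
      sqrt (\<Sum>j\<in>J. (e j - b)\<^sup>2) * sqrt (\<Sum>j\<in>J. (lam j - 1 / N)\<^sup>2)"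
    using L2_set_mult_ineq[of "\<lambda>j. e j - b" "\<lambda>j. lam j - 1 / N" J]
      sum_mono[of J "\<lambda>j. (e j - b) * (lam j - 1 / N)" "\<lambda>j. \<bar>e j - b\<bar> * \<bar>lam j - 1 / N\<bar>"]
    by (fastforce simp: L2_set_def simp flip: abs_mult)
  also have "\<dots> \<le> sqrt (N * (1 - b\<^sup>2)) * sqrt (real n / N)"
    unfolding se2[symmetric] using sl2 by (intro mult_left_mono) (auto intro!: sum_nonneg)
  also have "\<dots> = sqrt (real n * (1 - b\<^sup>2))"
    using N by (simp flip: real_sqrt_mult)
  also have "1 - b\<^sup>2 = (2 / N)\<^sup>2 * (m * (N - m))"
    using N by (simp add: b_def power2_eq_square field_simps)
  also have "sqrt (real n * ((2 / N)\<^sup>2 * (m * (N - m)))) = 2 * sqrt (real n) / N * sqrt (m * (N - m))"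
    using N by (simp add: real_sqrt_mult)
  finally show ?thesis by (simp add: phi_def N_def b_def m_def)
qed

corollary sum_abs_le_psi_k_num:
  fixes lam :: "'i \<Rightarrow> real"
  assumes "finite J" "card J = n + 1" "sum lam J = 1" "(\<Sum>j\<in>J. (lam j)\<^sup>2) \<le> 1"
  shows "(\<Sum>j\<in>J. \<bar>lam j\<bar>) \<le> psi n (k_num n)"
proof -
  have "card {j\<in>J. lam j < 0} \<le> n + 1"
    unfolding assms(2)[symmetric] using assms(1) by (auto intro!: card_mono)
  then show ?thesis using sum_abs_le_phi[OF assms] phi_le_psi_k_num by (metis order_trans)
qed

text \<open>
  Here \<open>(1 - t) / k\<close>, taken \<open>k\<close> times, and \<open>t / (N - k)\<close>, taken \<open>N - k\<close> times, are the coordinates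
  of a boundary point. Completing the square in the hypothesis gives
  \<open>(N t - (N - k))\<^sup>2 = n k (N - k)\<close>; the negative root would force \<open>t \<le> 0\<close>, because
  \<open>n k \<ge> N - k\<close> whenever \<open>k \<ge> 1\<close>.
\<close>

lemma psi_k_num_attained:
  fixes k t :: real
  assumes k: "k = k_num n" and n: "1 \<le> n" and t: "0 < t"
    and sq: "(1 - t)\<^sup>2 / k + t\<^sup>2 / (real n + 1 - k) = 1"
  shows "psi n k = 2 * t - 1"
proof -
  define N where "N = real n + 1"
  have N: "0 < N" by (simp add: N_def)
  have k1: "1 \<le> k" using k_num_ge_1[OF n] by (simp add: k)
  have "real_of_int (2 * k_num n) \<le> real_of_int (int n + 1)"
    using k_num_le_half[OF n] by (simp only: of_int_le_iff)
  then have k2: "k \<le> N / 2" by (simp add: k N_def)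
  have kN: "0 < N - k" using k1 k2 by linarith
  have "(N - k) * (1 - t)\<^sup>2 + k * t\<^sup>2 = k * (N - k)"
    using sq k1 kN by (simp add: N_def field_simps)
  then have "(N * t - (N - k))\<^sup>2 = (N - 1) * (k * (N - k))" by algebra
  then have root: "\<bar>N * t - (N - k)\<bar> = sqrt (real n) * sqrt (k * (N - k))"
    by (metis N_def add_diff_cancel_right' real_sqrt_abs real_sqrt_mult)
  have "0 \<le> N * t - (N - k)"
  proof (rule ccontr)
    assume neg: "\<not> 0 \<le> N * t - (N - k)"
    have "N - k \<le> real n * k" using k1 mult_left_mono[OF k1, of "real n"] by (simp add: N_def)
    then have "(N - k) * (N - k) \<le> (N - k) * (real n * k)" using kN by (intro mult_left_mono) auto
    then have "N - k \<le> sqrt (real n * (k * (N - k)))"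
      by (intro real_le_rsqrt) (simp add: power2_eq_square mult_ac)
    also have "\<dots> = - (N * t - (N - k))" using root neg by (simp add: real_sqrt_mult)
    finally have "N * t \<le> 0" by simp
    then show False using t by (simp add: N_def mult_le_0_iff)
  qed
  then have "N * t - (N - k) = sqrt (real n) * sqrt (k * (N - k))" using root by simp
  then have "phi n k = 2 * (N * t - (N - k)) / N + (1 - 2 * k / N)"
    by (simp add: phi_def N_def)
  also have "\<dots> = 2 * t - 1" using N by (simp add: field_simps)
  finally show ?thesis using k2 by (simp add: phi_eq_psi N_def)
qed

section \<open>Barycentric coordinates and the norm of the projector\<close>

lemma Pi1_affine_combination:
  assumes p: "p \<in> Pi1" and u: "sum u J = 1"
  shows "p (\<Sum>j\<in>J. u j *\<^sub>R z j) = (\<Sum>j\<in>J. u j * p (z j))"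
proof -
  obtain b a where pe: "p = (\<lambda>x. b + a \<bullet> x)"
    using p by (auto simp: Pi1_def inner_vec_def)
  show ?thesis
    by (simp add: pe inner_sum_right algebra_simps sum.distrib u flip: sum_distrib_left)
qed

lemma Pi1_continuous_on: "p \<in> Pi1 \<Longrightarrow> continuous_on A p"
  by (auto simp: Pi1_def intro!: continuous_intros)

text \<open>
  The vectors \<open>w\<^sub>j\<close> from the centre to the points have \<open>w\<^sub>i \<bullet> w\<^sub>j = r\<^sup>2 - l\<^sup>2 / 2\<close> for \<open>i \<noteq> j\<close> and
  \<open>r\<^sup>2\<close> for \<open>i = j\<close>: a constant matrix plus a multiple of the identity. The constant part
  contributes only through \<open>\<Sum> u\<^sub>j = 1\<close>, the identity part through \<open>\<Sum> u\<^sub>j\<^sup>2\<close>.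
\<close>

lemma dist_sphere_affine_combination:
  fixes z :: "'i \<Rightarrow> 'a::euclidean_space"
  assumes fin: "finite J" and u: "sum u J = 1"
    and sph: "\<And>j. j \<in> J \<Longrightarrow> dist c (z j) = r"
    and equi: "\<And>i j. i \<in> J \<Longrightarrow> j \<in> J \<Longrightarrow> i \<noteq> j \<Longrightarrow> dist (z i) (z j) = l"
  shows "(dist c (\<Sum>j\<in>J. u j *\<^sub>R z j))\<^sup>2 = r\<^sup>2 - l\<^sup>2 / 2 * (1 - (\<Sum>j\<in>J. (u j)\<^sup>2))"
proof -
  define w where "w j = z j - c" for j
  have w: "w i \<bullet> w j = r\<^sup>2 - l\<^sup>2 / 2 + (if i = j then l\<^sup>2 / 2 else 0)" if "i \<in> J" "j \<in> J" for i j
  proof (cases "i = j")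
    case True
    then show ?thesis using sph[of j] that
      by (simp add: w_def dist_norm norm_minus_commute flip: power2_norm_eq_inner)
  next
    case False
    have "l\<^sup>2 = (norm (w i - w j))\<^sup>2" using equi[OF that False] by (simp add: w_def dist_norm)
    also have "\<dots> = (norm (w i))\<^sup>2 + (norm (w j))\<^sup>2 - 2 * (w i \<bullet> w j)"
      by (simp add: power2_norm_eq_inner inner_diff_left inner_diff_right inner_commute)
    also have "\<dots> = r\<^sup>2 + r\<^sup>2 - 2 * (w i \<bullet> w j)"
      using sph[of i] sph[of j] that by (simp add: w_def dist_norm norm_minus_commute)
    finally show ?thesis using False by (simp add: field_simps)
  qed
  have "(\<Sum>j\<in>J. u j *\<^sub>R z j) - c = (\<Sum>j\<in>J. u j *\<^sub>R w j)"
    by (simp add: w_def scaleR_diff_right sum_subtractf u flip: scaleR_sum_left)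
  then have "(dist c (\<Sum>j\<in>J. u j *\<^sub>R z j))\<^sup>2 = (\<Sum>j\<in>J. u j *\<^sub>R w j) \<bullet> (\<Sum>j\<in>J. u j *\<^sub>R w j)"
    by (metis dist_commute dist_norm power2_norm_eq_inner)
  also have "\<dots> = (\<Sum>i\<in>J. \<Sum>j\<in>J. u i * u j * (w i \<bullet> w j))"
    by (simp only: inner_sum_left) (simp add: inner_sum_right sum_distrib_left mult_ac)
  also have "\<dots> = (\<Sum>i\<in>J. \<Sum>j\<in>J. (r\<^sup>2 - l\<^sup>2 / 2) * (u i * u j) + (if i = j then l\<^sup>2 / 2 * (u i * u j) else 0))"
    by (intro sum.cong) (auto simp: w algebra_simps)
  also have "\<dots> = (r\<^sup>2 - l\<^sup>2 / 2) * (sum u J * sum u J) + l\<^sup>2 / 2 * (\<Sum>j\<in>J. (u j)\<^sup>2)"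
  proof -
    have "(\<Sum>i\<in>J. \<Sum>j\<in>J. (r\<^sup>2 - l\<^sup>2 / 2) * (u i * u j)) = (r\<^sup>2 - l\<^sup>2 / 2) * (sum u J * sum u J)"
      by (subst sum_product) (simp only: sum_distrib_left)
    moreover have "(\<Sum>i\<in>J. \<Sum>j\<in>J. if i = j then l\<^sup>2 / 2 * (u i * u j) else 0) = l\<^sup>2 / 2 * (\<Sum>j\<in>J. (u j)\<^sup>2)"
      by (simp add: fin sum_distrib_left power2_eq_square)
    ultimately show ?thesis by (simp only: sum.distrib)
  qed
  finally show ?thesis by (simp add: u algebra_simps)
qed

lemma lagrange_basis_affine_combination:
  assumes lag: "lagrange_basis m x lam" and u: "sum u {1..m} = 1" and i: "i \<in> {1..m}"
  shows "lam i (\<Sum>j=1..m. u j *\<^sub>R x j) = u i"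
proof -
  have "lam i (\<Sum>j=1..m. u j *\<^sub>R x j) = (\<Sum>j=1..m. u j * lam i (x j))"
    using lag i by (intro Pi1_affine_combination u) (auto simp: lagrange_basis_def)
  also have "\<dots> = (\<Sum>j=1..m. if j = i then u j else 0)"
    using lag i by (intro sum.cong) (auto simp: lagrange_basis_def)
  also have "\<dots> = u i" using i by simp
  finally show ?thesis .
qed

text \<open>
  Affine spanning provides some weights for \<open>z\<close>; evaluating the affine functions \<open>\<lambda>\<^sub>i\<close> on that
  combination shows that the weights are the values \<open>\<lambda>\<^sub>i z\<close>.
\<close>

lemma lagrange_basis_barycentric:
  assumes lag: "lagrange_basis m x lam" and bij: "bij_betw x {1..m} V"
    and hull: "affine hull V = UNIV"
  shows "(\<Sum>j=1..m. lam j z) = 1" "(\<Sum>j=1..m. lam j z *\<^sub>R x j) = z"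
proof -
  have "finite V" using bij bij_betw_finite by blast
  then obtain w where w: "sum w V = 1" "(\<Sum>v\<in>V. w v *\<^sub>R v) = z"
    using hull affine_hull_finite[of V] by auto
  define u where "u = w \<circ> x"
  have u: "sum u {1..m} = 1" "(\<Sum>j=1..m. u j *\<^sub>R x j) = z"
    using sum.reindex_bij_betw[OF bij, of w] sum.reindex_bij_betw[OF bij, of "\<lambda>v. w v *\<^sub>R v"] w
    by (simp_all add: u_def)
  have "lam i z = u i" if "i \<in> {1..m}" for i
    using lagrange_basis_affine_combination[OF lag u(1) that] u(2) by simp
  then show "(\<Sum>j=1..m. lam j z) = 1" "(\<Sum>j=1..m. lam j z *\<^sub>R x j) = z" using u by simp_all
qed

text \<open>
  The bound \<open>\<le>\<close> is the triangle inequality in \<open>P f z = \<Sum>\<^sub>j \<lambda>\<^sub>j z * f (x\<^sub>j)\<close>. For equality a continuous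
  function of norm at most one with the values \<open>sgn (\<lambda>\<^sub>j y)\<close> at the nodes is needed: the affine
  interpolant of these values, truncated to \<open>[-1, 1]\<close>, is one.
\<close>

lemma C_opnorm_interpolation_projector:
  fixes B :: "(real ^ 'n) set"
  assumes lag: "lagrange_basis m x lam" and bij: "bij_betw x {1..m} V"
    and hull: "affine hull V = UNIV"
    and proj: "interpolation_projector B V P" and comp: "compact B"
    and y: "y \<in> B" and max: "\<And>z. z \<in> B \<Longrightarrow> (\<Sum>j=1..m. \<bar>lam j z\<bar>) \<le> (\<Sum>j=1..m. \<bar>lam j y\<bar>)"
  shows "C_opnorm B P = (\<Sum>j=1..m. \<bar>lam j y\<bar>)"
proof -
  define M where "M = (\<Sum>j=1..m. \<bar>lam j y\<bar>)"
  have xB: "x j \<in> B" if "j \<in> {1..m}" for j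
    using that bij proj by (auto simp: interpolation_projector_def bij_betw_def)
  have Pf: "P f z = (\<Sum>j=1..m. lam j z * f (x j))" if "continuous_on B f" for f z
  proof -
    have p: "P f \<in> Pi1" "\<And>j. j \<in> {1..m} \<Longrightarrow> P f (x j) = f (x j)"
      using proj that bij by (auto simp: interpolation_projector_def bij_betw_def)
    have "P f z = P f (\<Sum>j=1..m. lam j z *\<^sub>R x j)"
      by (simp only: lagrange_basis_barycentric(2)[OF lag bij hull])
    also have "\<dots> = (\<Sum>j=1..m. lam j z * P f (x j))"
      by (rule Pi1_affine_combination[OF p(1) lagrange_basis_barycentric(1)[OF lag bij hull]])
    also have "\<dots> = (\<Sum>j=1..m. lam j z * f (x j))" using p(2) by (intro sum.cong) auto
    finally show ?thesis .
  qed
  have le: "\<bar>P f z\<bar> \<le> M" if f: "continuous_on B f" "C_norm B f \<le> 1" and z: "z \<in> B" for f z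
  proof -
    have "compact ((\<lambda>x. \<bar>f x\<bar>) ` B)"
      using f comp by (intro compact_continuous_image continuous_intros)
    then have "bdd_above ((\<lambda>x. \<bar>f x\<bar>) ` B)" by (intro bounded_imp_bdd_above compact_imp_bounded)
    then have f1: "\<bar>f b\<bar> \<le> 1" if "b \<in> B" for b
      using cSUP_upper[OF that, of "\<lambda>x. \<bar>f x\<bar>"] f(2) unfolding C_norm_def by linarith
    have "\<bar>P f z\<bar> \<le> (\<Sum>j=1..m. \<bar>lam j z * f (x j)\<bar>)" unfolding Pf[OF f(1)] by (rule sum_abs)
    also have "\<dots> \<le> (\<Sum>j=1..m. \<bar>lam j z\<bar>)"
      using f1 xB by (intro sum_mono) (simp add: abs_mult mult_left_le)
    also have "\<dots> \<le> M" unfolding M_def by (rule max[OF z])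
    finally show ?thesis .
  qed
  have norm_le: "C_norm B (P f) \<le> M" if "continuous_on B f" "C_norm B f \<le> 1" for f
    unfolding C_norm_def using le[OF that] y by (intro cSUP_least) auto
  define f where "f z = max (-1) (min 1 (\<Sum>j=1..m. sgn (lam j y) * lam j z))" for z
  have f_cont: "continuous_on B f"
    unfolding f_def using lag
    by (intro continuous_intros Pi1_continuous_on) (auto simp: lagrange_basis_def)
  have f_norm: "C_norm B f \<le> 1"
    unfolding C_norm_def using y by (intro cSUP_least) (auto simp: f_def)
  have f_node: "f (x i) = sgn (lam i y)" if "i \<in> {1..m}" for i
  proof -
    have "(\<Sum>j=1..m. sgn (lam j y) * lam j (x i)) = (\<Sum>j=1..m. if j = i then sgn (lam j y) else 0)"
      using lag that by (intro sum.cong) (auto simp: lagrange_basis_def)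
    also have "\<dots> = sgn (lam i y)" using that by simp
    finally show ?thesis by (simp add: f_def sgn_if)
  qed
  have "P f y = (\<Sum>j=1..m. lam j y * sgn (lam j y))"
    unfolding Pf[OF f_cont] by (intro sum.cong) (auto simp: f_node)
  then have "P f y = M" by (simp add: M_def flip: abs_sgn)
  then have "M \<le> \<bar>P f y\<bar>" by simp
  also have "\<dots> \<le> C_norm B (P f)"
    unfolding C_norm_def using le[OF f_cont f_norm] y by (intro cSUP_upper bdd_aboveI2[of _ _ M]) auto
  finally have "C_norm B (P f) = M" using norm_le[OF f_cont f_norm] by simp
  then have "C_opnorm B P = M"
    unfolding C_opnorm_def using f_cont f_norm norm_le by (intro cSup_eq_maximum) force+
  then show ?thesis by (simp add: M_def)
qed

section \<open>Faces of a simplex\<close>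

lemma vertices_face:
  assumes "F face_of S"
  shows "vertices F = vertices S \<inter> F"
  using extreme_point_of_face[OF assms] by (auto simp: vertices_def)

lemma simplex_vertices:
  assumes "d simplex S"
  shows "\<not> affine_dependent (vertices S)" "int (card (vertices S)) = d + 1"
    "S = convex hull (vertices S)"
proof -
  obtain C where C: "\<not> affine_dependent C" "int (card C) = d + 1" "S = convex hull C"
    using assms by (auto simp: simplex_def)
  have "vertices S = C"
    using extreme_point_of_convex_hull_affine_independent[OF C(1)]
    by (auto simp: vertices_def C(3))
  then show "\<not> affine_dependent (vertices S)" "int (card (vertices S)) = d + 1"
    "S = convex hull (vertices S)" using C by auto
qed

lemma card_vertices_face:
  assumes "d simplex S" "F face_of S"
  shows "int (card (vertices F)) = aff_dim F + 1"
proof -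
  obtain C where C: "C \<subseteq> vertices S" "F = convex hull C"
    using face_of_convex_hull_affine_independent[of "vertices S"] assms simplex_vertices[OF assms(1)]
    by metis
  have ind: "\<not> affine_dependent C"
    using affine_dependent_subset[OF _ C(1)] simplex_vertices(1)[OF assms(1)] by blast
  have "vertices F = C"
    using extreme_point_of_convex_hull_affine_independent[OF ind]
    by (auto simp: vertices_def C(2))
  then show ?thesis
    using aff_dim_affine_independent[OF ind] by (simp add: C(2) aff_dim_convex_hull)
qed

text \<open>
  The point \<open>y\<close> is visibly an affine combination of the nodes with weight \<open>(1 - t) / card C\<close> on
  \<open>C\<close> and \<open>t / card D\<close> on \<open>D\<close>, so these are its barycentric coordinates.
\<close>

lemma lagrange_basis_on_line_of_centers:
  fixes x :: "nat \<Rightarrow> real ^ 'n"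
  assumes lag: "lagrange_basis m x lam" and bij: "bij_betw x {1..m} V"
    and part: "V = C \<union> D" "C \<inter> D = {}" and ne: "C \<noteq> {}" "D \<noteq> {}"
    and y: "y = (1 - t) *\<^sub>R ((\<Sum>v\<in>C. v) /\<^sub>R real (card C)) + t *\<^sub>R ((\<Sum>v\<in>D. v) /\<^sub>R real (card D))"
  shows "(\<Sum>j=1..m. \<bar>lam j y\<bar>) = \<bar>1 - t\<bar> + \<bar>t\<bar>"
    and "(\<Sum>j=1..m. (lam j y)\<^sup>2) = (1 - t)\<^sup>2 / real (card C) + t\<^sup>2 / real (card D)"
proof -
  define w where "w v = (if v \<in> C then (1 - t) / real (card C) else t / real (card D))" for v
  have fin: "finite C" "finite D" using bij bij_betw_finite part(1) by blast+
  then have pos: "0 < real (card C)" "0 < real (card D)" using ne by (simp_all add: card_gt_0_iff)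
  have split: "(\<Sum>v\<in>V. F v) = (\<Sum>v\<in>C. F v) + (\<Sum>v\<in>D. F v)" for F :: "real ^ 'n \<Rightarrow> 'b::comm_monoid_add"
    unfolding part(1) using fin part(2) by (rule sum.union_disjoint)
  have wC: "w v = (1 - t) / real (card C)" if "v \<in> C" for v using that by (simp add: w_def)
  have wD: "w v = t / real (card D)" if "v \<in> D" for v using that part(2) by (auto simp: w_def)
  have "sum w V = 1" using pos by (simp add: split wC wD)
  then have one: "(\<Sum>j=1..m. w (x j)) = 1" using sum.reindex_bij_betw[OF bij, of w] by simp
  have "(\<Sum>v\<in>V. w v *\<^sub>R v) = y"
    by (simp add: split wC wD y divide_inverse flip: scaleR_sum_right)
  then have "(\<Sum>j=1..m. w (x j) *\<^sub>R x j) = y"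
    using sum.reindex_bij_betw[OF bij, of "\<lambda>v. w v *\<^sub>R v"] by simp
  then have lamw: "lam j y = w (x j)" if "j \<in> {1..m}" for j
    using lagrange_basis_affine_combination[OF lag one that] by simp
  have reindex: "(\<Sum>j=1..m. F (lam j y)) = (\<Sum>v\<in>V. F (w v))" for F :: "real \<Rightarrow> real"
    using sum.reindex_bij_betw[OF bij, of "\<lambda>v. F (w v)"] by (simp add: lamw)
  show "(\<Sum>j=1..m. \<bar>lam j y\<bar>) = \<bar>1 - t\<bar> + \<bar>t\<bar>"
    using pos by (simp only: reindex[of abs] split) (simp add: wC wD)
  show "(\<Sum>j=1..m. (lam j y)\<^sup>2) = (1 - t)\<^sup>2 / real (card C) + t\<^sup>2 / real (card D)"
    using pos by (simp only: reindex[of "\<lambda>u. u\<^sup>2"] split)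
      (simp add: wC wD power_divide power2_eq_square)
qed

section \<open>The point on the line through the centres of gravity\<close>

theorem theorem1:
  fixes n :: nat and k :: int
    and c :: "real ^ 'n" and r :: real
    and B S G H :: "(real ^ 'n) set"
    and x :: "nat \<Rightarrow> real ^ 'n"
    and lam :: "nat \<Rightarrow> real ^ 'n \<Rightarrow> real"
    and P :: "(real ^ 'n \<Rightarrow> real) \<Rightarrow> (real ^ 'n \<Rightarrow> real)"
    and g h y :: "real ^ 'n" and t :: real
  assumes n: "n = CARD('n)" and k: "k = k_num n"
    and ball: "r > 0" "B = cball c r"
    and regular: "regular_simplex (int n) S"
    and inscribed: "vertices S \<subseteq> sphere c r"
    and nodes: "bij_betw x {1..n + 1} (vertices S)"
    and lagrange: "lagrange_basis (n + 1) x lam"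
    and projector: "interpolation_projector B (vertices S) P"
    and G: "G face_of S" "aff_dim G = k - 1"
    and H: "H face_of S" "aff_dim H = int n - k" "vertices S - G \<subseteq> H"
    and g: "g = center_of_gravity G" and h: "h = center_of_gravity H"
    and y: "t > 0" "y = g + t *\<^sub>R (h - g)" "y \<in> sphere c r"
  shows "(\<Sum>j = 1..n + 1. \<bar>lam j y\<bar>) = C_opnorm B P"
proof -
  have n1: "1 \<le> n" by (simp add: n Suc_leI)
  have simplex: "int n simplex S" using regular by (simp add: regular_simplex_def)
  note vert = simplex_vertices[OF simplex]
  have fin: "finite (vertices S)" using nodes bij_betw_finite by blast
  have cardS: "card (vertices S) = n + 1" using vert(2) by linarith
  have hull: "affine hull (vertices S) = UNIV"
    using affine_independent_span_eq[OF vert(1)] cardS by (simp add: n)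

  \<comment> \<open>The ball in barycentric coordinates. There are two vertices at least, so the edge length is
    nonzero and the distance formula can be solved for the sum of squares.\<close>
  have xV: "x j \<in> vertices S" if "j \<in> {1..n + 1}" for j
    using nodes that by (auto simp: bij_betw_def)
  obtain l where "\<forall>u\<in>vertices S. \<forall>v\<in>vertices S. u \<noteq> v \<longrightarrow> dist u v = l"
    using regular by (auto simp: regular_simplex_def)
  then have edge: "dist (x i) (x j) = l" if "i \<in> {1..n + 1}" "j \<in> {1..n + 1}" "i \<noteq> j" for i j
    using that xV nodes by (auto simp: bij_betw_def inj_on_eq_iff)
  have "x 1 \<noteq> x 2" using nodes n1 by (auto simp: bij_betw_def inj_on_eq_iff)
  then have l: "l \<noteq> 0" using edge[of 1 2] n1 by auto
  note bary = lagrange_basis_barycentric[OF lagrange nodes hull]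
  have dist: "(dist c z)\<^sup>2 = r\<^sup>2 - l\<^sup>2 / 2 * (1 - (\<Sum>j=1..n + 1. (lam j z)\<^sup>2))" for z
    using dist_sphere_affine_combination[of "{1..n + 1}" "\<lambda>j. lam j z" c x r l]
      bary[of z] edge xV inscribed by (auto simp: subset_iff)
  have in_ball: "(\<Sum>j=1..n + 1. (lam j z)\<^sup>2) \<le> 1" if "z \<in> B" for z
  proof -
    have "(dist c z)\<^sup>2 \<le> r\<^sup>2" using that ball by (intro power_mono) auto
    then have "0 \<le> l\<^sup>2 / 2 * (1 - (\<Sum>j=1..n + 1. (lam j z)\<^sup>2))" unfolding dist by simp
    then show ?thesis using l by (simp add: zero_le_mult_iff)
  qed
  have on_sphere: "(\<Sum>j=1..n + 1. (lam j y)\<^sup>2) = 1"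
    using dist[of y] y(3) l by simp

  have upper: "(\<Sum>j=1..n + 1. \<bar>lam j z\<bar>) \<le> psi n k" if "z \<in> B" for z
    unfolding k by (rule sum_abs_le_psi_k_num) (use bary in_ball that in auto)

  \<comment> \<open>The faces have \<open>k\<close> and \<open>n + 1 - k\<close> vertices and together cover all \<open>n + 1\<close> vertices, so by
    counting they share none.\<close>
  have cardG: "int (card (vertices G)) = k" and cardH: "int (card (vertices H)) = int n + 1 - k"
    using card_vertices_face[OF simplex G(1)] card_vertices_face[OF simplex H(1)] G(2) H(2) by auto
  have part: "vertices S = vertices G \<union> vertices H"
    using H(3) by (auto simp: vertices_face[OF G(1)] vertices_face[OF H(1)])
  have finGH: "finite (vertices G)" "finite (vertices H)" using fin part by auto
  have disj: "vertices G \<inter> vertices H = {}"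
    using card_Un_Int[OF finGH] cardG cardH cardS finGH unfolding part[symmetric]
    by (metis (no_types, lifting) card_0_eq finite_Int add_cancel_right_right diff_add_cancel
        add.commute of_nat_1 of_nat_add of_nat_eq_iff)
  have k1: "1 \<le> k" and k2: "2 * k \<le> int n + 1"
    using k_num_ge_1[OF n1] k_num_le_half[OF n1] by (simp_all add: k)
  have ne: "vertices G \<noteq> {}" "vertices H \<noteq> {}" using cardG cardH k1 k2 n1 by auto
  have "y = (1 - t) *\<^sub>R ((\<Sum>v\<in>vertices G. v) /\<^sub>R real (card (vertices G)))
          + t *\<^sub>R ((\<Sum>v\<in>vertices H. v) /\<^sub>R real (card (vertices H)))"
    by (simp only: y(2) g h center_of_gravity_def) (simp add: algebra_simps)
  note line = lagrange_basis_on_line_of_centers[OF lagrange nodes part disj ne this]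
  have cards: "real (card (vertices G)) = k" "real (card (vertices H)) = real n + 1 - k"
    using cardG cardH by linarith+
  have "psi n k = 2 * t - 1"
    using psi_k_num_attained[OF arg_cong[OF k, of real_of_int] n1 y(1)] line(2) on_sphere
    by (simp add: cards)
  also have "\<dots> \<le> (\<Sum>j=1..n + 1. \<bar>lam j y\<bar>)" unfolding line(1) by linarith
  finally have lower: "psi n k \<le> (\<Sum>j=1..n + 1. \<bar>lam j y\<bar>)" .
  have "C_opnorm B P = (\<Sum>j=1..n + 1. \<bar>lam j y\<bar>)"
  proof (rule C_opnorm_interpolation_projector[OF lagrange nodes hull projector])
    show "compact B" "y \<in> B" using ball y(3) by auto
    show "(\<Sum>j=1..n + 1. \<bar>lam j z\<bar>) \<le> (\<Sum>j=1..n + 1. \<bar>lam j y\<bar>)" if "z \<in> B" for z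
      using upper[OF that] lower by linarith
  qed
  then show ?thesis by simp
qed

end
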